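(* For primes $p<q$, the independence polynomial $$I(\varGamma(\mathbb{Z}_{p^2q}),x)=(1+x)^{(p-1)(p+q-1)}+(1+x)^{p(q-1)}-(1+x)^{(p-1)(q-1)}+(p-1)x(1+x)^{p(p-1)}$$ is log-concave and unimodal.
   Context: For a positive integer $n$, the zero divisor graph $\varGamma(\mathbb{Z}_n)$ is the simple undirected graph whose vertices are the non-zero zero divisors of the ring $\mathbb{Z}_n$ of integers modulo $n$ (non-zero $a$ such that $ab=0$ for some non-zero $b$), two distinct vertices $a,b$ being adjacent if and only if $ab=0$ in $\mathbb{Z}_n$. An independent set of a finite graph $G$ is a set of vertices no two of which are adjacent (the empty set included); $\alpha(G)$ is the maximum size of an independent set, and $s_k(G)$ is the number of independent sets of size $k$. The independence polynomial of $G$ is $I(G,x)=\sum_{k=0}^{\alpha(G)} s_k(G)x^k$. A polynomial $\sum_{i=0}^{n}\ell_i x^i$ (of degree $n$) is log-concave if $\ell_j^2\ge \ell_{j-1}\ell_{j+1}$ for all $1\le j\le n-1$; it is unimodal if there is an index $m$, $0\le m\le n$, with $\ell_0\le \ell_1\le\dots\le \ell_m\ge \ell_{m+1}\ge\dots\ge \ell_n$. *)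

theory Defs
  imports
    "HOL-Number_Theory.Residues"
    "HOL-Computational_Algebra.Polynomial"
    "Graph_Theory.Pair_Digraph"
begin

definition nonzero_zero_divisors :: "('a, 'b) ring_scheme \<Rightarrow> 'a set" where
  "nonzero_zero_divisors R =
     {a \<in> carrier R - {\<zero>\<^bsub>R\<^esub>}. \<exists>b \<in> carrier R - {\<zero>\<^bsub>R\<^esub>}. a \<otimes>\<^bsub>R\<^esub> b = \<zero>\<^bsub>R\<^esub>}"

text \<open>Simple undirected graphs are represented as in \<open>pair_graph\<close>: finite, loop-free, symmetric
  arc relations.\<close>

definition zero_divisor_graph :: "('a, 'b) ring_scheme \<Rightarrow> 'a pair_pre_digraph" where
  "zero_divisor_graph R =
     \<lparr> pverts = nonzero_zero_divisors R,
       parcs = {(a, b). a \<in> nonzero_zero_divisors R \<and> b \<in> nonzero_zero_divisors R \<and>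
                        a \<noteq> b \<and> a \<otimes>\<^bsub>R\<^esub> b = \<zero>\<^bsub>R\<^esub>} \<rparr>"

text \<open>The library's residue ring is only a ring for moduli greater than 1.
  For \<open>n = 1\<close> the graph below still comes out empty, as it should.\<close>

definition zero_divisor_graph_Z :: "nat \<Rightarrow> int pair_pre_digraph" where
  "zero_divisor_graph_Z n = zero_divisor_graph (residue_ring (int n))"

lemma pair_graph_zero_divisor_graph_Z:
  assumes "n > 0"
  shows "pair_graph (zero_divisor_graph_Z n)"
proof -
  let ?V = "nonzero_zero_divisors (residue_ring (int n))"
  have fin: "finite ?V"
    by (rule finite_subset[of _ "{0..int n - 1}"])
       (auto simp: nonzero_zero_divisors_def residue_ring_def)
  have "finite (parcs (zero_divisor_graph_Z n))"
    by (rule finite_subset[of _ "?V \<times> ?V"])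
       (auto simp: zero_divisor_graph_Z_def zero_divisor_graph_def fin)
  then show ?thesis
    using fin
    by unfold_locales
       (auto simp: zero_divisor_graph_Z_def zero_divisor_graph_def symmetric_def
          residue_ring_def mult.commute intro!: symI)
qed

definition independent_set :: "'a pair_pre_digraph \<Rightarrow> 'a set \<Rightarrow> bool" where
  "independent_set G S \<longleftrightarrow> S \<subseteq> pverts G \<and> (\<forall>u \<in> S. \<forall>v \<in> S. (u, v) \<notin> parcs G)"

text \<open>The next three notions are only meaningful for graphs with finitely many vertices.\<close>

definition independence_number :: "'a pair_pre_digraph \<Rightarrow> nat" where
  "independence_number G = Max (card ` {S. independent_set G S})"

definition num_independent_sets :: "'a pair_pre_digraph \<Rightarrow> nat \<Rightarrow> nat" where
  "num_independent_sets G k = card {S. independent_set G S \<and> card S = k}"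

definition independence_poly :: "'a pair_pre_digraph \<Rightarrow> int poly" where
  "independence_poly G =
     (\<Sum>k\<le>independence_number G. Polynomial.monom (int (num_independent_sets G k)) k)"

definition log_concave_poly :: "int poly \<Rightarrow> bool" where
  "log_concave_poly f \<longleftrightarrow>
     (\<forall>j. 1 \<le> j \<and> j < Polynomial.degree f \<longrightarrow>
        Polynomial.coeff f (j - 1) * Polynomial.coeff f (j + 1) \<le> (Polynomial.coeff f j)\<^sup>2)"

definition unimodal_poly :: "int poly \<Rightarrow> bool" where
  "unimodal_poly f \<longleftrightarrow>
     (\<exists>m \<le> Polynomial.degree f.
        (\<forall>i. i < m \<longrightarrow> Polynomial.coeff f i \<le> Polynomial.coeff f (i + 1)) \<and>
        (\<forall>i. m \<le> i \<and> i < Polynomial.degree f \<longrightarrow>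
           Polynomial.coeff f (i + 1) \<le> Polynomial.coeff f i))"

end

theory Submission
  imports Defs
begin

text \<open>The nonzero zero divisors modulo \<open>p\<^sup>2 q\<close> fall into four classes according to their gcd with
  \<open>p\<^sup>2 q\<close>, and adjacency depends only on the classes; this gives the formula. For log-concavity, put
  \<open>m = q - 1\<close>, \<open>n = p (p - 1)\<close> and \<open>d = (p - 1) (q - 1 - p)\<close>. The polynomial factors as
  \<open>(1 + x)^n H\<close> with \<open>H = (1 + x)^d ((1 + x)^m + (1 + x)^n - 1) + (p - 1) x\<close>. Multiplication by
  \<open>1 + x\<close> preserves log-concavity without internal zeros, and so does lowering the constant
  coefficient. Hence \<open>(1 + x)^m + (1 + x)^n = (1 + x)^m (1 + (1 + x)^(n - m))\<close> (say \<open>m \<le> n\<close>) shows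
  that the first summand of \<open>H\<close> is log-concave. Adding \<open>(p - 1) x\<close> can then only violate the
  condition at \<open>x\<^sup>2\<close>, which is an explicit inequality between binomial coefficients.\<close>

section \<open>Log-concave polynomials without internal zeros\<close>

text \<open>The zero condition forces the support to be an initial segment of the indices. With
  internal zeros, as in 1 + x^3, log-concavity neither survives multiplication by 1 + x nor gives
  unimodality.\<close>

definition strongly_log_concave :: "'a::linordered_idom poly \<Rightarrow> bool" where
  "strongly_log_concave f \<longleftrightarrow>
     (\<forall>j. 0 \<le> coeff f j) \<and> (\<forall>j. coeff f j = 0 \<longrightarrow> coeff f (Suc j) = 0) \<and>
     (\<forall>j. coeff f j * coeff f (Suc (Suc j)) \<le> (coeff f (Suc j))\<^sup>2)"

lemma strongly_log_concaveI:
  assumes "\<And>j. 0 \<le> coeff f j" and "\<And>j. coeff f j = 0 \<Longrightarrow> coeff f (Suc j) = 0"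
    and "\<And>j. coeff f j * coeff f (Suc (Suc j)) \<le> (coeff f (Suc j))\<^sup>2"
  shows "strongly_log_concave f"
  using assms by (simp add: strongly_log_concave_def)

lemma strongly_log_concaveD:
  assumes "strongly_log_concave f"
  shows "0 \<le> coeff f j" and "coeff f j = 0 \<Longrightarrow> coeff f (Suc j) = 0"
    and "coeff f j * coeff f (Suc (Suc j)) \<le> (coeff f (Suc j))\<^sup>2"
  using assms by (simp_all add: strongly_log_concave_def)

lemma coeff_linear_mult:
  fixes f :: "'a::comm_ring_1 poly"
  shows "coeff ([:1, 1:] * f) 0 = coeff f 0"
    and "coeff ([:1, 1:] * f) (Suc j) = coeff f (Suc j) + coeff f j"
  by (simp_all add: mult_pCons_left)

text \<open>For consecutive coefficients a, b, c, d the expansion needs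
  \<open>a * d \<le> b * c\<close> besides the two given inequalities. It follows by multiplying
  these and cancelling \<open>b * c\<close>; if \<open>b * c = 0\<close>, then d vanishes because
  there are no internal zeros.\<close>

lemma strongly_log_concave_mult_linear:
  assumes f: "strongly_log_concave f"
  shows "strongly_log_concave ([:1, 1:] * f)"
proof (rule strongly_log_concaveI)
  note D = strongly_log_concaveD[OF f]
  fix j
  show "0 \<le> coeff ([:1, 1:] * f) j"
    by (cases j) (simp_all only: coeff_linear_mult D add_nonneg_nonneg)
  show "coeff ([:1, 1:] * f) (Suc j) = 0" if "coeff ([:1, 1:] * f) j = 0"
  proof -
    have "coeff f j = 0"
      using that D(1) by (cases j) (simp_all only: coeff_linear_mult add_nonneg_eq_0_iff)
    then show ?thesis
      using D(2)[of j] by (simp only: coeff_linear_mult)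
  qed
  show "coeff ([:1, 1:] * f) j * coeff ([:1, 1:] * f) (Suc (Suc j)) \<le>
      (coeff ([:1, 1:] * f) (Suc j))\<^sup>2"
  proof (cases j)
    case 0
    have "0 \<le> coeff f 0 * coeff f (Suc 0)" "0 \<le> coeff f 0 * coeff f 0"
      using D(1) by simp_all
    moreover have "(coeff f (Suc 0) + coeff f 0)\<^sup>2 -
        coeff f 0 * (coeff f (Suc (Suc 0)) + coeff f (Suc 0)) =
        ((coeff f (Suc 0))\<^sup>2 - coeff f 0 * coeff f (Suc (Suc 0))) +
        coeff f 0 * coeff f (Suc 0) + coeff f 0 * coeff f 0"
      by (simp add: power2_eq_square algebra_simps)
    ultimately show ?thesis
      using D(3)[of 0] unfolding 0 coeff_linear_mult by linarith
  next
    case (Suc i)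
    define a b c d where "a = coeff f i" and "b = coeff f (Suc i)"
      and "c = coeff f (Suc (Suc i))" and "d = coeff f (Suc (Suc (Suc i)))"
    have nn: "0 \<le> a" "0 \<le> b" "0 \<le> c" "0 \<le> d"
      using D(1) by (simp_all add: a_def b_def c_def d_def)
    have ac: "a * c \<le> b\<^sup>2" and bd: "b * d \<le> c\<^sup>2"
      using D(3) by (simp_all add: a_def b_def c_def d_def)
    have "a * d \<le> b * c"
    proof (cases "b * c = 0")
      case True
      then have "d = 0"
        using D(2)[of "Suc i"] D(2)[of "Suc (Suc i)"] by (auto simp: b_def c_def d_def)
      then show ?thesis
        using True by (simp only: mult_zero_right)
    next
      case False
      have "(a * c) * (b * d) \<le> b\<^sup>2 * c\<^sup>2"
        using ac bd nn by (intro mult_mono) auto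
      then have "(b * c) * (a * d) \<le> (b * c) * (b * c)"
        by (simp add: power2_eq_square algebra_simps)
      moreover have "0 < b * c"
        using nn False by (simp add: order.not_eq_order_implies_strict)
      ultimately show ?thesis
        by (simp add: mult_le_cancel_left_pos)
    qed
    then have "(b + a) * (d + c) \<le> (c + b)\<^sup>2"
      using ac bd by (simp add: power2_eq_square algebra_simps)
    then show ?thesis
      unfolding Suc coeff_linear_mult a_def b_def c_def d_def .
  qed
qed

lemma strongly_log_concave_mult_linear_power:
  assumes "strongly_log_concave f"
  shows "strongly_log_concave ([:1, 1:] ^ n * f)"
  by (induction n) (simp_all only: assms power_0 mult_1_left power_Suc mult.assoc
      strongly_log_concave_mult_linear)

lemma strongly_log_concave_linear_power:
  "strongly_log_concave ([:1, 1:] ^ n :: 'a::linordered_idom poly)"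
proof -
  have "strongly_log_concave (1 :: 'a poly)"
    by (rule strongly_log_concaveI) (auto simp: coeff_1)
  from strongly_log_concave_mult_linear_power[OF this, of n] show ?thesis
    by simp
qed

text \<open>The constant coefficient enters only the inequality in degree 1, as a factor of the
  smaller side. The strict bound on c keeps it positive, so no zero precedes the other
  coefficients.\<close>

lemma strongly_log_concave_lower_coeff_0:
  assumes f: "strongly_log_concave f" and c: "0 \<le> c" "c < coeff f 0"
  shows "strongly_log_concave (f - [:c:])"
proof (rule strongly_log_concaveI)
  note D = strongly_log_concaveD[OF f]
  fix j
  show "0 \<le> coeff (f - [:c:]) j"
    using D(1)[of j] c by (cases j) simp_all
  show "coeff (f - [:c:]) (Suc j) = 0" if "coeff (f - [:c:]) j = 0"
    using that D(2)[of j] c by (cases j) simp_all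
  show "coeff (f - [:c:]) j * coeff (f - [:c:]) (Suc (Suc j)) \<le> (coeff (f - [:c:]) (Suc j))\<^sup>2"
  proof (cases j)
    case 0
    have "(coeff f 0 - c) * coeff f 2 \<le> coeff f 0 * coeff f 2"
      using c D(1) by (intro mult_right_mono) auto
    then show ?thesis
      using D(3)[of 0] by (simp add: 0 numeral_2_eq_2)
  next
    case (Suc i)
    then show ?thesis
      using D(3)[of j] by simp
  qed
qed

text \<open>In degree 1 the raised coefficient is squared, which only helps. It is a factor of the
  smaller side only in degree 2, where the inequality is assumed. A nonzero constant coefficient
  keeps the support an initial segment.\<close>

lemma strongly_log_concave_raise_coeff_1:
  assumes f: "strongly_log_concave f" and c: "0 \<le> c" and f0: "coeff f 0 \<noteq> 0"
    and ineq: "(coeff f 1 + c) * coeff f 3 \<le> (coeff f 2)\<^sup>2"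
  shows "strongly_log_concave (f + [:0, c:])"
proof (rule strongly_log_concaveI)
  note D = strongly_log_concaveD[OF f]
  fix j
  consider "j = 0" | "j = 1" | i where "j = Suc (Suc i)"
    by (metis One_nat_def not0_implies_Suc)
  note index = this
  show "0 \<le> coeff (f + [:0, c:]) j"
    using D(1)[of j] c by (cases rule: index) simp_all
  show "coeff (f + [:0, c:]) (Suc j) = 0" if "coeff (f + [:0, c:]) j = 0"
  proof (cases rule: index)
    case 1
    then show ?thesis
      using that f0 by simp
  next
    case 2
    then show ?thesis
      using that D(1)[of 1] D(2)[of 1] c by (simp add: add_nonneg_eq_0_iff)
  next
    case 3
    then show ?thesis
      using that D(2)[of j] by simp
  qed
  show "coeff (f + [:0, c:]) j * coeff (f + [:0, c:]) (Suc (Suc j)) \<le>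
      (coeff (f + [:0, c:]) (Suc j))\<^sup>2"
  proof (cases rule: index)
    case 1
    have "(coeff f 1)\<^sup>2 \<le> (coeff f 1 + c)\<^sup>2"
      using D(1)[of 1] c by (intro power_mono) auto
    then show ?thesis
      using D(3)[of 0] by (simp add: 1)
  next
    case 2
    then show ?thesis
      using ineq by (simp add: eval_nat_numeral)
  next
    case 3
    then show ?thesis
      using D(3)[of j] by simp
  qed
qed

section \<open>Powers of 1 + x and their sums\<close>

lemma coeff_linear_1_1_power:
  "coeff ([:1, 1:] ^ n :: 'a::comm_semiring_1 poly) k = of_nat (n choose k)"
proof (cases "k \<le> n")
  case True
  then show ?thesis
    using coeff_linear_poly_power[of k n "1::'a" 1] by simp
next
  case False
  have "degree ([:1, 1:] ^ n :: 'a poly) \<le> degree [:1, 1 :: 'a:] * n"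
    by (rule degree_power_le)
  also have "\<dots> \<le> 1 * n"
    by (intro mult_right_mono) auto
  finally have "degree ([:1, 1:] ^ n :: 'a poly) < k"
    using False by simp
  then show ?thesis
    using False by (simp add: coeff_eq_0 binomial_eq_0)
qed

text \<open>With denominators cleared and subtraction taken in the integers, inequalities between
  binomial coefficients become polynomial ones, valid for small n as well.\<close>

lemma two_mult_choose_two: "2 * int (n choose 2) = int n * (int n - 1)"
proof -
  have "even (n * (n - 1))"
    by (cases "even n") simp_all
  then have "int (2 * (n choose 2)) = int (n * (n - 1))"
    by (simp only: choose_two dvd_mult_div_cancel)
  then show ?thesis
    by (cases n) (simp_all add: algebra_simps)
qed

lemma six_mult_choose_three: "6 * int (n choose 3) = int n * (int n - 1) * (int n - 2)"
proof (induction n)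
  case (Suc n)
  have "Suc n choose 3 = (n choose 2) + (n choose 3)"
    by (simp add: eval_nat_numeral)
  then show ?case
    using Suc two_mult_choose_two[of n] by (simp add: algebra_simps)
qed simp

text \<open>Only the constant coefficient differs from that of the power, being 2, so the one new
  condition is n (n - 1) \<le> n^2 in degree 1.\<close>

lemma strongly_log_concave_one_plus_linear_power:
  "strongly_log_concave (1 + [:1, 1:] ^ n :: int poly)"
proof (rule strongly_log_concaveI)
  note D = strongly_log_concaveD[OF strongly_log_concave_linear_power[of n, where 'a = int]]
  fix j
  show "0 \<le> coeff (1 + [:1, 1:] ^ n :: int poly) j"
    using D(1)[of j] by (simp add: coeff_1)
  show "coeff (1 + [:1, 1:] ^ n :: int poly) (Suc j) = 0"
    if "coeff (1 + [:1, 1:] ^ n :: int poly) j = 0"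
    using that D(1)[of j] D(2)[of j] by (cases j) (simp_all add: coeff_1)
  show "coeff (1 + [:1, 1:] ^ n :: int poly) j * coeff (1 + [:1, 1:] ^ n) (Suc (Suc j)) \<le>
      (coeff (1 + [:1, 1:] ^ n) (Suc j))\<^sup>2"
  proof (cases j)
    case 0
    have "2 * int (n choose 2) \<le> (int n)\<^sup>2"
      unfolding two_mult_choose_two by (simp add: power2_eq_square algebra_simps)
    then show ?thesis
      by (simp add: 0 coeff_1 coeff_linear_1_1_power numeral_2_eq_2)
  next
    case (Suc i)
    then show ?thesis
      using D(3)[of j] by (simp add: coeff_1)
  qed
qed

lemma strongly_log_concave_sum_linear_powers:
  "strongly_log_concave ([:1, 1:] ^ m + [:1, 1:] ^ n - 1 :: int poly)"
proof -
  have le: "strongly_log_concave ([:1, 1:] ^ m + [:1, 1:] ^ n - 1 :: int poly)"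
    if "m \<le> n" for m n
  proof -
    have eq: "[:1, 1:] ^ m + [:1, 1:] ^ n = [:1, 1:] ^ m * (1 + [:1, 1:] ^ (n - m) :: int poly)"
      using that by (simp only: distrib_left mult_1_right flip: power_add) simp
    have "strongly_log_concave ([:1, 1:] ^ m + [:1, 1:] ^ n :: int poly)"
      unfolding eq
      by (intro strongly_log_concave_mult_linear_power strongly_log_concave_one_plus_linear_power)
    \<comment> \<open>The constant coefficient of the sum is 2, so subtracting 1 leaves it
      positive.\<close>
    from strongly_log_concave_lower_coeff_0[OF this, of 1] show ?thesis
      by (simp add: coeff_linear_1_1_power one_pCons)
  qed
  show ?thesis
    using le[of m n] le[of n m] by (cases "m \<le> n") (simp_all add: add.commute)
qed

section \<open>Log-concavity and unimodality as consequences\<close>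

lemma strongly_log_concave_imp_log_concave_poly:
  assumes "strongly_log_concave f"
  shows "log_concave_poly f"
  unfolding log_concave_poly_def
proof (intro allI impI)
  fix j assume "1 \<le> j \<and> j < degree f"
  then show "coeff f (j - 1) * coeff f (j + 1) \<le> (coeff f j)\<^sup>2"
    using strongly_log_concaveD(3)[OF assms, of "j - 1"] by simp
qed

text \<open>The mode is the first index without a strict ascent. By log-concavity a non-ascent at a
  nonzero coefficient forces one at the next index; after a zero everything vanishes.\<close>

lemma strongly_log_concave_imp_unimodal_poly:
  assumes f: "strongly_log_concave f"
  shows "unimodal_poly f"
proof -
  note D = strongly_log_concaveD[OF f]
  define m where "m = (LEAST i. coeff f (Suc i) \<le> coeff f i)"
  \<comment> \<open>The coefficient beyond the degree is 0, so a non-ascent exists and the first one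
    is at most the degree.\<close>
  have top: "coeff f (Suc (degree f)) \<le> coeff f (degree f)"
    using D(1) by (simp add: coeff_eq_0)
  have m: "coeff f (Suc m) \<le> coeff f m"
    unfolding m_def using top by (rule LeastI)
  have "m \<le> degree f"
    unfolding m_def using top by (rule Least_le)
  moreover have "coeff f i \<le> coeff f (i + 1)" if "i < m" for i
    using not_less_Least[of i "\<lambda>i. coeff f (Suc i) \<le> coeff f i"] that by (simp add: m_def)
  moreover have "coeff f (i + 1) \<le> coeff f i" if "m \<le> i" for i
    using that
  proof (induction i rule: dec_induct)
    case base
    then show ?case
      using m by simp
  next
    case (step i)
    show ?case
    proof (cases "coeff f i = 0")
      case True
      then show ?thesis
        using D(2)[of i] D(2)[of "Suc i"] by simp
    next
      case False
      have "coeff f i * coeff f (Suc (Suc i)) \<le> (coeff f (Suc i))\<^sup>2"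
        by (rule D)
      also have "\<dots> \<le> coeff f i * coeff f (Suc i)"
        using step.IH D(1) by (simp add: power2_eq_square mult_right_mono)
      finally show ?thesis
        using False D(1)[of i] by (simp add: mult_le_cancel_left)
    qed
  qed
  ultimately show ?thesis
    unfolding unimodal_poly_def by blast
qed

section \<open>Independence polynomials as sums over independent sets\<close>

text \<open>Expanding the product of x + 1 over A chooses, for each element, whether it belongs to
  the subset.\<close>

lemma sum_Pow_monom_card:
  assumes "finite A"
  shows "(\<Sum>S\<in>Pow A. monom 1 (card S)) = ([:1, 1:] ^ card A :: 'a::comm_semiring_1 poly)"
proof -
  have "([:1, 1:] ^ card A :: 'a poly) = (\<Prod>x\<in>A. [:0, 1:] + 1)"
    by (simp add: one_pCons)
  also have "\<dots> = (\<Sum>S\<in>Pow A. [:0, 1:] ^ card S)"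
    by (subst prod_add[OF assms]) simp
  finally show ?thesis
    by (simp add: monom_altdef)
qed

text \<open>Independent sets are grouped by size; the independence number bounds all sizes, so
  stopping the sum there loses nothing.\<close>

lemma independence_poly_eq_sum:
  assumes "finite (pverts G)"
  shows "independence_poly G = (\<Sum>S | independent_set G S. monom 1 (card S))"
proof -
  let ?I = "{S. independent_set G S}"
  have fin: "finite ?I"
    by (rule finite_subset[of _ "Pow (pverts G)"]) (auto simp: independent_set_def assms)
  have "independence_poly G =
      (\<Sum>k\<le>independence_number G. \<Sum>S | S \<in> ?I \<and> card S = k. monom 1 (card S))"
    unfolding independence_poly_def
  proof (intro sum.cong refl)
    fix k
    have "(\<Sum>S | S \<in> ?I \<and> card S = k. monom (1::int) (card S)) =
        (\<Sum>S | independent_set G S \<and> card S = k. monom 1 k)"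
      by (intro sum.cong) auto
    also have "\<dots> = of_nat (num_independent_sets G k) * monom 1 k"
      by (simp add: num_independent_sets_def)
    also have "\<dots> = monom (int (num_independent_sets G k)) k"
      by (simp add: of_nat_poly smult_monom)
    finally show "monom (int (num_independent_sets G k)) k =
        (\<Sum>S | S \<in> ?I \<and> card S = k. monom 1 (card S))" ..
  qed
  also have "\<dots> = (\<Sum>S\<in>?I. monom 1 (card S))"
    using fin by (intro sum.group) (auto simp: independence_number_def)
  finally show ?thesis .
qed

text \<open>The index set consists of the independent sets of a graph with vertex classes \<open>P\<close>, \<open>Q\<close>,
  \<open>R\<close>, \<open>Z\<close> in which \<open>Q\<close> is completely joined to \<open>R\<close>, and \<open>Z\<close> is a clique completely joined
  to \<open>P\<close> and \<open>R\<close>.\<close>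

lemma sum_monom_card_joined_classes:
  assumes fin: "finite P" "finite Q" "finite R" "finite Z"
    and disj: "P \<inter> R = {}" "P \<inter> Q = {}" "Q \<inter> R = {}" "Z \<inter> (P \<union> Q \<union> R) = {}"
  shows "(\<Sum>S\<in>Pow (P \<union> R) \<union> Pow (P \<union> Q) \<union> (\<lambda>(z, T). insert z T) ` (Z \<times> Pow Q).
             monom 1 (card S)) =
         ([:1, 1:] ^ card (P \<union> Q) + [:1, 1:] ^ card (P \<union> R) - [:1, 1:] ^ card P
            + smult (int (card Z)) ([:0, 1:] * [:1, 1:] ^ card Q) :: int poly)"
proof -
  let ?g = "\<lambda>S. monom 1 (card S) :: int poly" and ?ins = "\<lambda>(z, T). insert z T"
  \<comment> \<open>As \<open>Z\<close> is disjoint from \<open>Q\<close>, z is the only element of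
    \<open>insert z T\<close> in \<open>Z\<close>, so the pair can be recovered.\<close>
  have "inj_on ?ins (Z \<times> Pow Q)"
  proof (rule inj_onI, clarify)
    fix z T z' T'
    assume "z \<in> Z" "z' \<in> Z" "T \<subseteq> Q" "T' \<subseteq> Q" and eq: "insert z T = insert z' T'"
    then have nm: "z \<notin> T" "z \<notin> T'" "z' \<notin> T" "z' \<notin> T'"
      using disj(4) by blast+
    then have "z = z'"
      using eq by blast
    then show "z = z' \<and> T = T'"
      using nm eq by (simp add: insert_ident)
  qed
  then have "sum ?g (?ins ` (Z \<times> Pow Q)) = (\<Sum>(z, T)\<in>Z \<times> Pow Q. ?g (insert z T))"
    by (simp add: sum.reindex case_prod_unfold)
  also have "\<dots> = (\<Sum>(z, T)\<in>Z \<times> Pow Q. [:0, 1:] * ?g T)"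
  proof (intro sum.cong refl, clarify)
    fix z T
    assume z: "z \<in> Z" and T: "T \<subseteq> Q"
    then have "z \<notin> T" "finite T"
      using disj(4) fin(2) by (auto intro: finite_subset)
    then show "?g (insert z T) = [:0, 1:] * ?g T"
      by (simp add: monom_altdef)
  qed
  also have "\<dots> = (\<Sum>z\<in>Z. [:0, 1:] * sum ?g (Pow Q))"
    by (simp only: sum.cartesian_product[symmetric] sum_distrib_left)
  also have "\<dots> = smult (int (card Z)) ([:0, 1:] * [:1, 1:] ^ card Q)"
    by (simp only: sum_Pow_monom_card[OF fin(2)] sum_constant) (simp add: of_nat_poly)
  finally have Z: "sum ?g (?ins ` (Z \<times> Pow Q)) =
      smult (int (card Z)) ([:0, 1:] * [:1, 1:] ^ card Q)" .
  \<comment> \<open>Inclusion-exclusion: the subsets of \<open>P\<close> are counted twice, which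
    yields the subtracted power.\<close>
  have "Pow (P \<union> R) \<inter> Pow (P \<union> Q) = Pow P"
    using disj by blast
  then have "sum ?g (Pow (P \<union> R) \<union> Pow (P \<union> Q)) =
      [:1, 1:] ^ card (P \<union> Q) + [:1, 1:] ^ card (P \<union> R) - [:1, 1:] ^ card P"
    using fin by (simp add: sum_Un sum_Pow_monom_card)
  moreover have "(Pow (P \<union> R) \<union> Pow (P \<union> Q)) \<inter> ?ins ` (Z \<times> Pow Q) = {}"
    using disj(4) by auto
  ultimately show ?thesis
    using fin Z by (subst sum.union_disjoint) simp_all
qed

section \<open>The zero divisor graph\<close>

lemma card_multiples:
  fixes d e :: nat
  assumes "0 < d" "0 < e"
  shows "card {a \<in> {0..int (d * e) - 1}. int d dvd a} = e"
proof -
  have "{a \<in> {0..int (d * e) - 1}. int d dvd a} = (\<lambda>k. int (d * k)) ` {..<e}"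
  proof (intro Set.set_eqI iffI)
    fix a assume a: "a \<in> {a \<in> {0..int (d * e) - 1}. int d dvd a}"
    then obtain k where k: "a = int d * k"
      by (auto elim: dvdE)
    have "0 \<le> int d * k" "int d * k < int d * int e"
      using a k by auto
    then have "0 \<le> k" "k < int e"
      using assms(1) by (simp_all add: zero_le_mult_iff)
    then show "a \<in> (\<lambda>k. int (d * k)) ` {..<e}"
      using k by (intro image_eqI[of _ _ "nat k"]) auto
  next
    fix a assume "a \<in> (\<lambda>k. int (d * k)) ` {..<e}"
    then obtain k where k: "k < e" "a = int (d * k)"
      by auto
    then have "d * k < d * e"
      using assms(1) by simp
    then have "int (d * k) < int (d * e)"
      by (simp only: of_nat_less_iff)
    then show "a \<in> {a \<in> {0..int (d * e) - 1}. int d dvd a}"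
      using k by simp
  qed
  moreover have "inj_on (\<lambda>k. int (d * k)) {..<e}"
    using assms(1) by (auto intro: inj_onI)
  ultimately show ?thesis
    by (simp add: card_image)
qed

lemma nonzero_zero_divisors_residue_ring:
  fixes n :: int
  shows "nonzero_zero_divisors (residue_ring n) =
    {a \<in> {1..n - 1}. \<exists>b \<in> {1..n - 1}. n dvd a * b}"
proof -
  have "{0..n - 1} - {0} = {1..n - 1}"
    by auto
  then show ?thesis
    by (simp add: nonzero_zero_divisors_def residue_ring_def dvd_eq_mod_eq_0)
qed

lemma independent_set_zero_divisor_graph_Z:
  "independent_set (zero_divisor_graph_Z n) S \<longleftrightarrow>
     S \<subseteq> nonzero_zero_divisors (residue_ring (int n)) \<and>
     (\<forall>a\<in>S. \<forall>b\<in>S. a \<noteq> b \<longrightarrow> \<not> int n dvd a * b)"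
proof -
  let ?R = "residue_ring (int n)"
  have mult: "a \<otimes>\<^bsub>?R\<^esub> b = \<zero>\<^bsub>?R\<^esub> \<longleftrightarrow> int n dvd a * b" for a b
    by (simp add: residue_ring_def mod_eq_0_iff_dvd)
  show ?thesis
    unfolding independent_set_def zero_divisor_graph_Z_def zero_divisor_graph_def by (auto simp: mult)
qed

text \<open>The classes \<open>P\<close>, \<open>Q\<close>, \<open>R\<close>, \<open>Z\<close>
  collect the vertices whose gcd with the modulus is p, q, p^2 and pq. An independent set lies in
  \<open>P \<union> Q\<close>, or in \<open>P \<union> R\<close>, or consists of one element of
  \<open>Z\<close> and a subset of \<open>Q\<close>; the exponents are the sizes of
  \<open>P \<union> Q\<close>, \<open>P \<union> R\<close>, \<open>P\<close> and
  \<open>Q\<close>.\<close>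

lemma independence_poly_zero_divisor_graph_Z:
  fixes p q :: nat
  assumes p: "prime p" and q: "prime q" and neq: "p \<noteq> q"
  shows "independence_poly (zero_divisor_graph_Z (p\<^sup>2 * q)) =
           [:1, 1:] ^ ((p - 1) * (p + q - 1)) + [:1, 1:] ^ (p * (q - 1))
           - [:1, 1:] ^ ((p - 1) * (q - 1))
           + smult (int (p - 1)) ([:0, 1:] * [:1, 1:] ^ (p * (p - 1)))"
proof -
  define n where "n = p\<^sup>2 * q"
  \<comment> \<open>Zero is kept here so that a divisor d of n has exactly n/d multiples. Each class
    below subtracts a set containing 0.\<close>
  define M where "M d = {a \<in> {0..int n - 1}. int d dvd a}" for d
  define P where "P = M p - (M (p\<^sup>2) \<union> M (p * q))"
  define Q where "Q = M q - M (p * q)"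
  define R where "R = M (p\<^sup>2) - M n"
  define Z where "Z = M (p * q) - M n"
  have pos: "0 < p" "0 < q" "1 < p" "1 < q"
    using p q by (simp_all only: prime_gt_0_nat prime_gt_1_nat)
  have prime: "prime (int p)" "prime (int q)"
    using p q by simp_all
  have cop: "coprime (int p) (int q)"
    using prime neq by (simp add: primes_coprime)
  have pq_iff: "int p * int q dvd a \<longleftrightarrow> int p dvd a \<and> int q dvd a" for a
    using cop by (metis divides_mult dvd_mult_left dvd_mult_right)
  have ppq_iff: "(int p)\<^sup>2 * int q dvd a \<longleftrightarrow> (int p)\<^sup>2 dvd a \<and> int q dvd a" for a
    using cop by (metis coprime_power_left_iff divides_mult dvd_mult_left dvd_mult_right)
  have pp: "int p dvd a" if "(int p)\<^sup>2 dvd a" for a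
    using that by (simp add: power2_eq_square dvd_mult_left)
  have qab: "int q dvd a * b \<longleftrightarrow> int q dvd a \<or> int q dvd b" for a b
    using prime by (simp add: prime_dvd_mult_iff)
  have ppab: "(int p)\<^sup>2 dvd a" if "(int p)\<^sup>2 dvd a * b" "\<not> int p dvd b" for a b
  proof -
    have "coprime ((int p)\<^sup>2) b"
      using prime that(2) by (simp add: prime_imp_coprime)
    then show ?thesis
      using that(1) by (simp add: coprime_dvd_mult_left_iff)
  qed
  have pp_prod: "(int p)\<^sup>2 dvd a * b" if "int p dvd a" "int p dvd b" for a b
    using that by (simp add: power2_eq_square mult_dvd_mono)
  have int_n: "int n = (int p)\<^sup>2 * int q"
    by (simp add: n_def)
  have n_pos: "0 < n"
    using pos by (simp add: n_def)
  have Mn: "M n = {0}"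
    using n_pos zdvd_not_zless[of _ "int n"] by (force simp: M_def)

  have memP: "a \<in> P \<longleftrightarrow> 0 \<le> a \<and> a < int n \<and> int p dvd a \<and> \<not> (int p)\<^sup>2 dvd a \<and> \<not> int q dvd a" for a
    by (auto simp: P_def M_def pq_iff)
  have memQ: "a \<in> Q \<longleftrightarrow> 0 \<le> a \<and> a < int n \<and> int q dvd a \<and> \<not> int p dvd a" for a
    by (auto simp: Q_def M_def pq_iff)
  have memR: "a \<in> R \<longleftrightarrow> 0 \<le> a \<and> a < int n \<and> (int p)\<^sup>2 dvd a \<and> \<not> int q dvd a" for a
    by (auto simp: R_def M_def int_n ppq_iff)
  have memZ: "a \<in> Z \<longleftrightarrow> 0 \<le> a \<and> a < int n \<and> int p dvd a \<and> int q dvd a \<and> \<not> (int p)\<^sup>2 dvd a" for a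
    by (auto simp: Z_def M_def int_n pq_iff ppq_iff)
  have fin_M: "finite (M d)" for d
    by (rule finite_subset[of _ "{0..int n - 1}"]) (auto simp: M_def)
  have fin: "finite P" "finite Q" "finite R" "finite Z"
    by (simp_all add: P_def Q_def R_def Z_def fin_M)
  have disj: "P \<inter> R = {}" "P \<inter> Q = {}" "Q \<inter> R = {}" "Z \<inter> (P \<union> Q \<union> R) = {}"
    using pp by (auto simp: memP memQ memR memZ)

  \<comment> \<open>Sizes of the vertex classes\<close>
  have card_M: "card (M d) = e" if "d * e = n" for d e
    using card_multiples[of d e] that n_pos by (auto simp: M_def)
  have cards_M: "card (M p) = p * q" "card (M q) = p\<^sup>2" "card (M (p\<^sup>2)) = q"
      "card (M (p * q)) = p" "card (M n) = 1"
    by (rule card_M; simp add: n_def power2_eq_square)+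
  have sub: "M (p * q) \<subseteq> M p" "M (p * q) \<subseteq> M q" "M n \<subseteq> M (p\<^sup>2)" "M n \<subseteq> M (p * q)"
      "M (p\<^sup>2) \<subseteq> M p"
    using pp by (auto simp: M_def pq_iff int_n ppq_iff)
  have card_Q: "card Q = p * (p - 1)"
    by (simp add: Q_def card_Diff_subset fin_M sub cards_M power2_eq_square diff_mult_distrib2)
  have card_Z: "card Z = p - 1"
    by (simp add: Z_def card_Diff_subset fin_M sub cards_M)
  \<comment> \<open>The two sets removed in \<open>P\<close> overlap in 0, whereas
    \<open>P \<union> R\<close> is a difference of nested sets; the size of \<open>P\<close> then
    follows from that of \<open>R\<close>.\<close>
  have "P \<union> R = M p - M (p * q)"
    using pp by (auto simp: memP memR) (auto simp: M_def pq_iff)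
  then have card_PR: "card (P \<union> R) = p * (q - 1)"
    by (simp add: card_Diff_subset fin_M sub cards_M diff_mult_distrib2)
  have "card (P \<union> R) = card P + card R"
    using fin disj by (simp add: card_Un_disjoint)
  moreover have "card R = q - 1"
    by (simp add: R_def card_Diff_subset fin_M sub cards_M)
  ultimately have card_P: "card P = (p - 1) * (q - 1)"
    using card_PR by (simp add: diff_mult_distrib)
  have "card (P \<union> Q) = card P + card Q"
    using fin disj by (simp add: card_Un_disjoint)
  also have "\<dots> = (p - 1) * (p + q - 1)"
    using pos by (cases p; cases q) (simp_all add: card_P card_Q algebra_simps)
  finally have card_PQ: "card (P \<union> Q) = (p - 1) * (p + q - 1)" .

  \<comment> \<open>The vertex set\<close>
  have verts: "nonzero_zero_divisors (residue_ring (int n)) = P \<union> Q \<union> R \<union> Z"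
  proof (intro Set.set_eqI iffI)
    fix a assume "a \<in> nonzero_zero_divisors (residue_ring (int n))"
    then obtain b where a: "1 \<le> a" "a < int n" and b: "1 \<le> b" "b < int n"
        and dvd: "int n dvd a * b"
      unfolding nonzero_zero_divisors_residue_ring by auto
    have "\<not> int n dvd a" "\<not> int n dvd b"
      using a b zdvd_not_zless[of _ "int n"] by auto
    \<comment> \<open>If neither prime divided a, all of n would divide b. These two facts are
      exactly what places a in one of the classes.\<close>
    then have "int p dvd a \<or> int q dvd a" "\<not> ((int p)\<^sup>2 dvd a \<and> int q dvd a)"
      using dvd ppab[of b a] by (auto simp: int_n ppq_iff qab mult.commute[of a b])
    then show "a \<in> P \<union> Q \<union> R \<union> Z"
      using a by (auto simp: memP memQ memR memZ)
  next
    fix a assume a: "a \<in> P \<union> Q \<union> R \<union> Z"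
    have "a \<noteq> 0"
      using a by (auto simp: memP memQ memR memZ)
    then have range: "a \<in> {1..int n - 1}"
      using a by (auto simp: memP memQ memR memZ)
    have "\<exists>b \<in> {1..int n - 1}. int n dvd a * b"
    \<comment> \<open>The annihilating partner is pq when p divides a, and p^2 otherwise, since then
      q divides a.\<close>
    proof (cases "int p dvd a")
      case True
      have "int p * int q < int n"
        using pos by (simp add: int_n power2_eq_square)
      moreover have "int n dvd a * (int p * int q)"
        using True pp_prod[of a "int p * int q"] by (simp add: int_n ppq_iff)
      moreover have "0 < int p * int q"
        using pos by simp
      ultimately show ?thesis
        by (intro bexI[of _ "int p * int q"]) auto
    next
      case False
      then have "int q dvd a"
        using a pp by (auto simp: memP memQ memR memZ)
      then have "int n dvd a * (int p)\<^sup>2"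
        by (simp add: int_n ppq_iff)
      moreover have "(int p)\<^sup>2 < int n" "0 < (int p)\<^sup>2"
        using pos by (simp_all add: int_n)
      ultimately show ?thesis
        by (intro bexI[of _ "(int p)\<^sup>2"]) auto
    qed
    then show "a \<in> nonzero_zero_divisors (residue_ring (int n))"
      using range unfolding nonzero_zero_divisors_residue_ring by blast
  qed

  \<comment> \<open>Adjacency and independent sets\<close>
  have edge: "int n dvd a * b \<longleftrightarrow>
      a \<in> Z \<and> b \<in> Z \<or> a \<in> Z \<and> b \<in> P \<union> R \<or> b \<in> Z \<and> a \<in> P \<union> R \<or> a \<in> R \<and> b \<in> Q \<or> a \<in> Q \<and> b \<in> R"
    if "a \<in> P \<union> Q \<union> R \<union> Z" "b \<in> P \<union> Q \<union> R \<union> Z" for a b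
  proof -
    \<comment> \<open>The two prime powers are treated separately: p^2 divides the product iff it
      divides a factor or p divides both. With p^2 dividing a implying p dividing a, the class
      description becomes propositional.\<close>
    have "int n dvd a * b \<longleftrightarrow> (int q dvd a \<or> int q dvd b) \<and>
        ((int p)\<^sup>2 dvd a \<or> (int p)\<^sup>2 dvd b \<or> int p dvd a \<and> int p dvd b)"
      unfolding int_n ppq_iff qab
      using ppab[of a b] ppab[of b a, unfolded mult.commute[of b a]] pp_prod[of a b]
        dvd_mult2[of "(int p)\<^sup>2" a b] dvd_mult[of "(int p)\<^sup>2" b a] by blast
    moreover have "0 \<le> a" "a < int n" "0 \<le> b" "b < int n"
      using that by (auto simp: memP memQ memR memZ)
    moreover have "(int p)\<^sup>2 dvd a \<longrightarrow> int p dvd a" "(int p)\<^sup>2 dvd b \<longrightarrow> int p dvd b"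
      using pp by blast+
    ultimately show ?thesis
      using that unfolding Un_iff memP memQ memR memZ by argo
  qed
  have indep: "{S. independent_set (zero_divisor_graph_Z n) S} =
      Pow (P \<union> R) \<union> Pow (P \<union> Q) \<union> (\<lambda>(z, T). insert z T) ` (Z \<times> Pow Q)"
  proof (intro Set.set_eqI iffI)
    fix S assume "S \<in> {S. independent_set (zero_divisor_graph_Z n) S}"
    then have S: "S \<subseteq> P \<union> Q \<union> R \<union> Z"
        and "\<forall>a\<in>S. \<forall>b\<in>S. a \<noteq> b \<longrightarrow> \<not> int n dvd a * b"
      by (simp_all add: independent_set_zero_divisor_graph_Z verts)
    then have no_edge: "a = b \<or> \<not> (a \<in> Z \<and> b \<in> Z \<or> a \<in> Z \<and> b \<in> P \<union> R \<or> a \<in> R \<and> b \<in> Q)"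
      if "a \<in> S" "b \<in> S" for a b
      using edge[of a b] that by blast
    show "S \<in> Pow (P \<union> R) \<union> Pow (P \<union> Q) \<union> (\<lambda>(z, T). insert z T) ` (Z \<times> Pow Q)"
    \<comment> \<open>Without elements of \<open>Z\<close>, only the join of \<open>Q\<close> and
      \<open>R\<close> matters. An element of \<open>Z\<close> excludes \<open>P\<close>,
      \<open>R\<close> and the rest of \<open>Z\<close>, leaving \<open>Q\<close>.\<close>
    proof (cases "S \<inter> Z = {}")
      case True
      have "S \<inter> R = {} \<or> S \<inter> Q = {}"
        using no_edge disj(3) by blast
      then show ?thesis
        using S True by blast
    next
      case False
      then obtain z where z: "z \<in> S" "z \<in> Z"
        by blast
      have "S - {z} \<subseteq> Q"
        using no_edge[OF z(1)] z(2) S by blast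
      then have "S = (\<lambda>(z, T). insert z T) (z, S - {z}) \<and> (z, S - {z}) \<in> Z \<times> Pow Q"
        using z by auto
      then show ?thesis
        by blast
    qed
  next
    fix S assume "S \<in> Pow (P \<union> R) \<union> Pow (P \<union> Q) \<union> (\<lambda>(z, T). insert z T) ` (Z \<times> Pow Q)"
    then have shape: "S \<subseteq> P \<union> R \<or> S \<subseteq> P \<union> Q \<or> (\<exists>z T. S = insert z T \<and> z \<in> Z \<and> T \<subseteq> Q)"
      by auto
    then have S: "S \<subseteq> P \<union> Q \<union> R \<union> Z"
      by blast
    moreover have "\<not> int n dvd a * b" if ab: "a \<in> S" "b \<in> S" "a \<noteq> b" for a b
    proof -
      have "a \<in> P \<union> Q \<union> R \<union> Z" "b \<in> P \<union> Q \<union> R \<union> Z"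
        using S ab by blast+
      note edge = edge[OF this]
      from shape consider "S \<subseteq> P \<union> R" | "S \<subseteq> P \<union> Q"
        | z T where "S = insert z T" "z \<in> Z" "T \<subseteq> Q"
        by blast
      then show ?thesis
      proof cases
        case 1
        then have "a \<in> P \<union> R" "b \<in> P \<union> R"
          using ab by blast+
        then show ?thesis
          unfolding edge using disj by blast
      next
        case 2
        then have "a \<in> P \<union> Q" "b \<in> P \<union> Q"
          using ab by blast+
        then show ?thesis
          unfolding edge using disj by blast
      next
        case (3 z T)
        then have "a \<in> Q \<and> b \<in> Q \<or> a \<in> Z \<and> b \<in> Q \<or> a \<in> Q \<and> b \<in> Z"
          using ab by blast
        then show ?thesis
          unfolding edge using disj by blast
      qed
    qed
    ultimately show "S \<in> {S. independent_set (zero_divisor_graph_Z n) S}"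
      by (simp add: independent_set_zero_divisor_graph_Z verts)
  qed
  have "finite (pverts (zero_divisor_graph_Z n))"
    using fin by (simp add: zero_divisor_graph_Z_def zero_divisor_graph_def verts)
  from independence_poly_eq_sum[OF this] show ?thesis
    by (simp only: indep sum_monom_card_joined_classes[OF fin disj] card_PQ card_PR card_P card_Q card_Z
        flip: n_def)
qed

section \<open>Log-concavity\<close>

text \<open>As a polynomial in \<open>p - 2\<close> and \<open>r\<close>, the difference of the two sides has only nonnegative
  coefficients.\<close>

lemma choose_sum_log_concave_at_2:
  fixes p r :: nat
  assumes "2 \<le> p"
  defines "d \<equiv> (p - 1) * r" and "m \<equiv> p + r" and "n \<equiv> p * (p - 1)"
  defines "K \<equiv> \<lambda>i. int ((d + m) choose i) + int ((d + n) choose i) - int (d choose i)"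
  shows "(K 1 + int (p - 1)) * K 3 \<le> (K 2)\<^sup>2"
proof -
  \<comment> \<open>The numbers \<open>K i\<close> are the coefficients of (1 + x)^d ((1 + x)^m + (1
    + x)^n - 1). Shifting p by 2 lets both variables range over all nonnegative integers.\<close>
  obtain u where p: "p = u + 2"
    using assms(1) by (metis add.commute le_Suc_ex)
  define x y where "x = int u" and "y = int r"
  have xy: "0 \<le> x" "0 \<le> y"
    by (simp_all add: x_def y_def)
  define D M N where "D = (x + 1) * y" and "M = x + 2 + y" and "N = (x + 2) * (x + 1)"
  have int: "int d = D" "int m = M" "int n = N"
    by (simp_all add: d_def m_def n_def D_def M_def N_def p x_def y_def algebra_simps)
  define K2 K3 where "K2 = (D + M) * (D + M - 1) + (D + N) * (D + N - 1) - D * (D - 1)"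
    and "K3 = (D + M) * (D + M - 1) * (D + M - 2) + (D + N) * (D + N - 1) * (D + N - 2)
      - D * (D - 1) * (D - 2)"
  have K1: "K 1 = D + M + N"
    by (simp add: K_def int)
  have K2: "2 * K 2 = K2"
    using two_mult_choose_two[of "d + m"] two_mult_choose_two[of "d + n"] two_mult_choose_two[of d]
    by (simp add: K_def K2_def int)
  have K3: "6 * K 3 = K3"
    using six_mult_choose_three[of "d + m"] six_mult_choose_three[of "d + n"]
      six_mult_choose_three[of d]
    by (simp add: K_def K3_def int)
  \<comment> \<open>As \<open>K2\<close> is \<open>2 * K 2\<close> and \<open>K3\<close> is
    \<open>6 * K 3\<close>, the weights 3 and 2 make this 12 times the desired difference.\<close>
  have "3 * K2\<^sup>2 - 2 * (D + M + N + (x + 1)) * K3 = 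
      x ^ 8 + 4 * x ^ 7 * y + 8 * x ^ 7 + 6 * x ^ 6 * y ^ 2 + 38 * x ^ 6 * y + 26 * x ^ 6
      + 4 * x ^ 5 * y ^ 3 + 60 * x ^ 5 * y ^ 2 + 174 * x ^ 5 * y + 58 * x ^ 5 + x ^ 4 * y ^ 4
      + 38 * x ^ 4 * y ^ 3 + 264 * x ^ 4 * y ^ 2 + 508 * x ^ 4 * y + 139 * x ^ 4
      + 8 * x ^ 3 * y ^ 4 + 140 * x ^ 3 * y ^ 3 + 636 * x ^ 3 * y ^ 2 + 972 * x ^ 3 * y
      + 284 * x ^ 3 + 24 * x ^ 2 * y ^ 4 + 254 * x ^ 2 * y ^ 3 + 869 * x ^ 2 * y ^ 2
      + 1142 * x ^ 2 * y + 344 * x ^ 2 + 32 * x * y ^ 4 + 232 * x * y ^ 3 + 638 * x * y ^ 2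
      + 736 * x * y + 208 * x + 16 * y ^ 4 + 88 * y ^ 3 + 200 * y ^ 2 + 200 * y + 48"
    unfolding K2_def K3_def D_def M_def N_def by Groebner_Basis.algebra
  also have "\<dots> \<ge> 0"
    using xy by (intro add_nonneg_nonneg mult_nonneg_nonneg zero_le_power) simp_all
  finally have "2 * (D + M + N + (x + 1)) * (6 * K 3) \<le> 3 * (2 * K 2)\<^sup>2"
    by (simp add: K2 K3)
  then have "(D + M + N + (x + 1)) * K 3 \<le> (K 2)\<^sup>2"
    by (simp only: power_mult_distrib mult.assoc mult.left_commute[of _ 6]) simp
  moreover have "K 1 + int (p - 1) = D + M + N + (x + 1)"
    using K1 by (simp add: p x_def)
  ultimately show ?thesis
    by simp
qed

lemma strongly_log_concave_formula:
  fixes p q :: nat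
  assumes p: "2 \<le> p" and "p < q"
  shows "strongly_log_concave
          ([:1, 1:] ^ ((p - 1) * (p + q - 1)) + [:1, 1:] ^ (p * (q - 1))
           - [:1, 1:] ^ ((p - 1) * (q - 1))
           + smult (int (p - 1)) ([:0, 1:] * [:1, 1:] ^ (p * (p - 1))) :: int poly)"
proof -
  \<comment> \<open>By p < q the number r = q - 1 - p is natural, so n is at most the smallest of
    the first three exponents, (p - 1)(q - 1) = n + d, and (1 + x)^n can be factored out.\<close>
  obtain r where q: "q = p + r + 1"
    using \<open>p < q\<close> by (auto dest: less_imp_add_positive simp: less_iff_Suc_add)
  define d m n where "d = (p - 1) * r" and "m = p + r" and "n = p * (p - 1)"
  define K :: "int poly" where "K = [:1, 1:] ^ d * ([:1, 1:] ^ m + [:1, 1:] ^ n - 1)"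
  have K_eq: "K = [:1, 1:] ^ (d + m) + [:1, 1:] ^ (d + n) - [:1, 1:] ^ d"
    by (simp only: K_def power_add right_diff_distrib distrib_left mult_1_right)
  have "strongly_log_concave K"
    unfolding K_def
    by (intro strongly_log_concave_mult_linear_power strongly_log_concave_sum_linear_powers)
  moreover have "(coeff K 1 + int (p - 1)) * coeff K 3 \<le> (coeff K 2)\<^sup>2"
    using choose_sum_log_concave_at_2[OF p, of r]
    by (simp only: K_eq coeff_add coeff_diff coeff_linear_1_1_power d_def m_def n_def)
  moreover have "coeff K 0 \<noteq> 0"
    by (simp add: K_eq coeff_linear_1_1_power)
  ultimately have "strongly_log_concave (K + [:0, int (p - 1):])"
    by (intro strongly_log_concave_raise_coeff_1) simp_all
  then have "strongly_log_concave ([:1, 1:] ^ n * (K + [:0, int (p - 1):]))"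
    by (rule strongly_log_concave_mult_linear_power)
  moreover have "[:1, 1:] ^ n * (K + [:0, int (p - 1):]) =
      [:1, 1:] ^ (n + (d + n)) + [:1, 1:] ^ (n + (d + m)) - [:1, 1:] ^ (n + d)
      + smult (int (p - 1)) ([:0, 1:] * [:1, 1:] ^ n)"
  proof -
    have "[:0, int (p - 1):] = smult (int (p - 1)) [:0, 1:]"
      by simp
    then show ?thesis
      unfolding K_eq power_add by (simp only: algebra_simps mult_smult_right)
  qed
  moreover have "n + (d + n) = (p - 1) * (p + q - 1)" "n + (d + m) = p * (q - 1)"
      "n + d = (p - 1) * (q - 1)"
    using p by (auto simp: n_def d_def m_def q le_iff_add algebra_simps)
  ultimately show ?thesis
    by (simp only: n_def)
qed

theorem theorem3p2:
  fixes p q :: nat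
  assumes "prime p" and "prime q" and "p < q"
  shows "independence_poly (zero_divisor_graph_Z (p\<^sup>2 * q)) =
           [:1, 1:] ^ ((p - 1) * (p + q - 1)) + [:1, 1:] ^ (p * (q - 1))
           - [:1, 1:] ^ ((p - 1) * (q - 1))
           + smult (int (p - 1)) ([:0, 1:] * [:1, 1:] ^ (p * (p - 1)))
         \<and> log_concave_poly (independence_poly (zero_divisor_graph_Z (p\<^sup>2 * q)))
         \<and> unimodal_poly (independence_poly (zero_divisor_graph_Z (p\<^sup>2 * q)))"
proof -
  have "p \<noteq> q"
    using assms(3) by simp
  note eq = independence_poly_zero_divisor_graph_Z[OF assms(1,2) this]
  have "strongly_log_concave (independence_poly (zero_divisor_graph_Z (p\<^sup>2 * q)))"
    unfolding eq using prime_ge_2_nat[OF assms(1)] assms(3) by (rule strongly_log_concave_formula)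
  then show ?thesis
    by (intro conjI eq strongly_log_concave_imp_log_concave_poly
        strongly_log_concave_imp_unimodal_poly)
qed

end
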